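(* Let $G$ be a finite group and $x\in G$ with $d=o(x)$. Then $x$ is a dominant vertex in $\Delta^o(G)$ if and only if $d\mid l_G$.
   Context: $o(g)$ denotes the order of $g\in G$. The order super commuting graph $\Delta^o(G)$ is the simple undirected graph with vertex set $G$ in which two distinct elements $g,h$ are adjacent iff either $o(g)=o(h)$, or there exist $g',h'\in G$ with $o(g')=o(g)$, $o(h')=o(h)$ such that $g'$ and $h'$ are distinct and commute. A vertex is dominant if it is adjacent to every other vertex. Let $K_G=\{o(x): x\in G\}$, partially ordered by divisibility, and let $\mu_G=\{d_1,d_2,\ldots,d_k\}$ be the set of maximal elements of $K_G$. Define $l_G=\gcd(d_1,d_2,\ldots,d_k)$ if $k\geq 2$, and $l_G=d_1$ if $k=1$. *)

theory Defs
  imports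
    "HOL-Algebra.Multiplicative_Group"
    "Graph_Theory.Pair_Digraph"
begin

text \<open>Simple undirected graphs are represented as in the Graph Theory entry: loop-free
  symmetric digraphs without parallel arcs (locale \<open>pair_graph\<close>).\<close>

definition order_super_commuting_graph :: "('a, 'b) monoid_scheme \<Rightarrow> 'a pair_pre_digraph"
  where
  "order_super_commuting_graph G =
     \<lparr> pverts = carrier G,
       parcs = {(g, h). g \<in> carrier G \<and> h \<in> carrier G \<and> g \<noteq> h \<and>
         (group.ord G g = group.ord G h \<or>
          (\<exists>g' \<in> carrier G. \<exists>h' \<in> carrier G.
             group.ord G g' = group.ord G g \<and> group.ord G h' = group.ord G h \<and>
             g' \<noteq> h' \<and> g' \<otimes>\<^bsub>G\<^esub> h' = h' \<otimes>\<^bsub>G\<^esub> g'))} \<rparr>"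

lemma pair_graph_order_super_commuting_graph:
  assumes "finite (carrier G)"
  shows "pair_graph (order_super_commuting_graph G)"
proof
  have "parcs (order_super_commuting_graph G) \<subseteq> carrier G \<times> carrier G"
    by (auto simp: order_super_commuting_graph_def)
  then show "finite (parcs (order_super_commuting_graph G))"
    using assms by (meson finite_SigmaI finite_subset)
  have "sym (parcs (order_super_commuting_graph G))"
    unfolding order_super_commuting_graph_def sym_def by (simp; metis)
  then show "symmetric (with_proj (order_super_commuting_graph G))"
    by (simp add: symmetric_def)
qed (auto simp: order_super_commuting_graph_def assms)

definition dominant_vertex :: "'v pair_pre_digraph \<Rightarrow> 'v \<Rightarrow> bool" where
  "dominant_vertex D v \<longleftrightarrow>
     v \<in> pverts D \<and> (\<forall>w \<in> pverts D. w \<noteq> v \<longrightarrow> (v, w) \<in> parcs D)"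

definition element_orders :: "('a, 'b) monoid_scheme \<Rightarrow> nat set" where
  "element_orders G = group.ord G ` carrier G"

definition maximal_element_orders :: "('a, 'b) monoid_scheme \<Rightarrow> nat set" where
  "maximal_element_orders G =
     {d \<in> element_orders G. \<forall>e \<in> element_orders G. d dvd e \<longrightarrow> e = d}"

text \<open>\<open>Gcd {d} = d\<close> on \<^typ>\<open>nat\<close>, so the case of a single maximal element order needs no
  separate clause.\<close>

definition gcd_maximal_orders :: "('a, 'b) monoid_scheme \<Rightarrow> nat" where
  "gcd_maximal_orders G = Gcd (maximal_element_orders G)"

end

theory Submission
  imports Defs "HOL-Computational_Algebra.Primes"
begin

text \<open>If an element of order \<open>d\<close> commutes with one of maximal order \<open>m\<close> but \<open>d\<close> does not divide
  \<open>m\<close>, some prime \<open>p\<close> occurs in \<open>d\<close> to a higher power than in \<open>m\<close>; multiplying suitable powers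
  of the two elements then gives an element whose order is a proper multiple of \<open>m\<close>, a
  contradiction. Conversely, if \<open>d\<close> divides all maximal orders and \<open>e\<close> is any element order, then
  \<open>e\<close> and \<open>d\<close> both divide some maximal order, so powers of a single element realise both.\<close>

context group
begin

lemma nat_pow_commute:
  fixes i j :: nat
  assumes "a \<otimes> b = b \<otimes> a" "a \<in> carrier G" "b \<in> carrier G"
  shows "a [^] i \<otimes> b [^] j = b [^] j \<otimes> a [^] i"
proof -
  have "a [^] i \<otimes> b = b \<otimes> a [^] i"
    using group_commutes_pow assms by blast
  then show ?thesis
    using group_commutes_pow[of b "a [^] i" j] assms by simp
qed

text \<open>With exponent \<open>?n * ord b\<close> both \<open>a \<otimes> b\<close> and
  \<open>b\<close> become trivial, so the same power of \<open>a\<close> does too; coprimality then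
  cancels the factor \<open>ord b\<close>. Applied with the roles of \<open>a\<close> and
  \<open>b\<close> exchanged as well, this gives the exact order of the product.\<close>

lemma ord_dvd_ord_mult_coprime:
  assumes "a \<otimes> b = b \<otimes> a" "a \<in> carrier G" "b \<in> carrier G" "coprime (ord a) (ord b)"
  shows "ord a dvd ord (a \<otimes> b)"
proof -
  let ?n = "ord (a \<otimes> b)"
  have "(a \<otimes> b) [^] (?n * ord b) = \<one>"
    using assms by (simp add: pow_eq_id)
  moreover have "(a \<otimes> b) [^] (?n * ord b) = a [^] (?n * ord b) \<otimes> b [^] (?n * ord b)"
    using assms by (intro pow_mult_distrib)
  moreover have "b [^] (?n * ord b) = \<one>"
    using assms by (simp add: pow_eq_id)
  ultimately have "a [^] (?n * ord b) = \<one>"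
    using assms by (metis nat_pow_closed r_one)
  then have "ord a dvd ?n * ord b"
    using assms pow_eq_id by blast
  then show ?thesis
    using assms(4) by (simp add: coprime_dvd_mult_left_iff)
qed

lemma ord_mult_coprime:
  assumes "a \<otimes> b = b \<otimes> a" "a \<in> carrier G" "b \<in> carrier G" "coprime (ord a) (ord b)"
  shows "ord (a \<otimes> b) = ord a * ord b"
proof (rule dvd_antisym)
  show "ord (a \<otimes> b) dvd ord a * ord b"
    using ord_mul_divides assms by blast
  have "ord b dvd ord (a \<otimes> b)"
    using ord_dvd_ord_mult_coprime[of b a] assms by (simp add: coprime_commute)
  then show "ord a * ord b dvd ord (a \<otimes> b)"
    using ord_dvd_ord_mult_coprime[OF assms] assms(4) by (simp add: divides_mult)
qed

lemma ord_eq_div_pow: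
  assumes "finite (carrier G)" "z \<in> carrier G" "e dvd ord z"
  shows "ord (z [^] (ord z div e)) = e"
proof -
  \<comment> \<open>An element of infinite order would have \<open>ord\<close> 0, and the power
    below would be \<open>\<one>\<close>; finiteness excludes this.\<close>
  have "ord z > 0"
    using assms ord_ge_1 by force
  moreover obtain c where "ord z = e * c"
    using assms(3) by blast
  ultimately show ?thesis
    using ord_pow[of z c] assms(2) by simp
qed

lemma ord_dvd_maximal_order:
  assumes fin: "finite (carrier G)"
    and a: "a \<in> carrier G" and b: "b \<in> carrier G" and comm: "a \<otimes> b = b \<otimes> a"
    and max: "ord b \<in> maximal_element_orders G"
  shows "ord a dvd ord b"
proof (rule multiplicity_le_imp_dvd)
  show "ord a \<noteq> 0"
    using ord_ge_1[OF fin a] by simp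
  fix p :: nat
  assume p: "prime p"
  define k where "k = multiplicity p (ord b)"
  have pos: "ord b > 0"
    using ord_ge_1[OF fin b] by simp
  show "multiplicity p (ord a) \<le> multiplicity p (ord b)"
  proof (rule ccontr)
    assume "\<not> ?thesis"
    \<comment> \<open>One factor \<open>p\<close> more than in \<open>ord b\<close> is enough, so
      \<open>?u\<close> need not carry the full \<open>p\<close>-part of
      \<open>ord a\<close>.\<close>
    then have "p ^ Suc k dvd ord a"
      unfolding k_def by (intro multiplicity_dvd') simp
    then have ord_u: "ord (a [^] (ord a div p ^ Suc k)) = p ^ Suc k" (is "ord ?u = _")
      using fin a by (rule ord_eq_div_pow[rotated 2])
    \<comment> \<open>\<open>m\<close> is the \<open>p\<close>-free part of \<open>ord b\<close>.
      Passing from \<open>b\<close> to \<open>?v\<close> strips the factor \<open>p ^ k\<close>, and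
      multiplying by \<open>?u\<close> puts \<open>p ^ Suc k\<close> in its place.\<close>
    obtain m where m: "ord b = p ^ k * m" "\<not> p dvd m"
      using multiplicity_decompose'[of "ord b" p] pos p unfolding k_def
      by (metis neq0_conv not_prime_unit)
    have ord_v: "ord (b [^] (ord b div m)) = m" (is "ord ?v = _")
      using fin b by (rule ord_eq_div_pow) (simp add: m(1))
    have "coprime (p ^ Suc k) m"
      using prime_imp_coprime[OF p m(2)] by (rule coprime_power_left_iff[THEN iffD2, OF disjI1])
    then have "ord (?u \<otimes> ?v) = p ^ Suc k * m"
      using ord_mult_coprime[of ?u ?v] nat_pow_commute[OF comm a b] a b ord_u ord_v by simp
    then have "ord (?u \<otimes> ?v) = p * ord b"
      using m(1) by simp
    moreover have "ord (?u \<otimes> ?v) \<in> element_orders G"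
      using a b unfolding element_orders_def by blast
    \<comment> \<open>The new order is a multiple of \<open>ord b\<close>, so maximality forces
      equality.\<close>
    ultimately have "p * ord b = ord b"
      using max unfolding maximal_element_orders_def by auto
    then show False
      using pos p by simp
  qed
qed

text \<open>Among the finitely many element orders divisible by \<open>ord y\<close>, the
  numerically largest is also maximal for divisibility: any element order that it divides is again
  divisible by \<open>ord y\<close>, hence no larger.\<close>

lemma element_order_dvd_maximal_order:
  assumes fin: "finite (carrier G)" and y: "y \<in> carrier G"
  obtains z where "z \<in> carrier G" "ord y dvd ord z" "ord z \<in> maximal_element_orders G"
proof -
  let ?S = "{e \<in> element_orders G. ord y dvd e}"
  have S: "finite ?S"
    using fin unfolding element_orders_def by simp
  moreover have "ord y \<in> ?S"
    using y unfolding element_orders_def by simp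
  ultimately have Max_S: "Max ?S \<in> ?S"
    using Max_in by blast
  then obtain z where z: "z \<in> carrier G" "ord z = Max ?S"
    unfolding element_orders_def by auto
  have "e = ord z" if e: "e \<in> element_orders G" and dvd: "ord z dvd e" for e
  proof (rule antisym)
    have "e \<in> ?S"
      using Max_S z(2) e dvd by (auto intro: dvd_trans)
    then show "e \<le> ord z"
      using S z(2) by simp
    \<comment> \<open>Divisibility bounds the divisor only for positive \<open>e\<close>, since
      everything divides 0.\<close>
    have "e > 0"
      using e ord_ge_1[OF fin] unfolding element_orders_def by force
    then show "ord z \<le> e"
      using dvd by (simp add: dvd_imp_le)
  qed
  then have "ord z \<in> maximal_element_orders G"
    using z(1) unfolding maximal_element_orders_def element_orders_def by blast
  then show thesis
    using that z Max_S by auto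
qed

end

theorem theorem4p3:
  fixes G :: "('a, 'b) monoid_scheme" and x :: 'a and d :: nat
  assumes "group G"
    and "finite (carrier G)"
    and "x \<in> carrier G"
    and "d = group.ord G x"
  shows "dominant_vertex (order_super_commuting_graph G) x \<longleftrightarrow> d dvd gcd_maximal_orders G"
proof -
  interpret group G by fact
  show ?thesis
  proof
    assume dom: "dominant_vertex (order_super_commuting_graph G) x"
    show "d dvd gcd_maximal_orders G"
      unfolding gcd_maximal_orders_def
    proof (rule Gcd_greatest)
      fix m
      assume m: "m \<in> maximal_element_orders G"
      then obtain y where y: "y \<in> carrier G" "m = ord y"
        unfolding maximal_element_orders_def element_orders_def by blast
      show "d dvd m"
      \<comment> \<open>Equal orders make the goal trivial. Different orders force
        \<open>x \<noteq> y\<close>, so dominance yields an edge, and this edge can only come from a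
        commuting pair.\<close>
      proof (cases "ord x = ord y")
        case False
        then have "(x, y) \<in> parcs (order_super_commuting_graph G)"
          using dom y unfolding dominant_vertex_def order_super_commuting_graph_def by auto
        then obtain a b where "a \<in> carrier G" "b \<in> carrier G" "ord a = ord x" "ord b = ord y"
          "a \<otimes>\<^bsub>G\<^esub> b = b \<otimes>\<^bsub>G\<^esub> a"
          using False unfolding order_super_commuting_graph_def by auto
        then show ?thesis
          using ord_dvd_maximal_order[of a b] assms m y by simp
      qed (simp add: assms y)
    qed
  next
    assume d: "d dvd gcd_maximal_orders G"
    have "(x, y) \<in> parcs (order_super_commuting_graph G)"
      if y: "y \<in> carrier G" "y \<noteq> x" for y
    proof (cases "ord x = ord y")
      case True
      then show ?thesis
        using assms y unfolding order_super_commuting_graph_def by auto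
    next
      case False
      obtain z where z: "z \<in> carrier G" "ord y dvd ord z" "ord z \<in> maximal_element_orders G"
        using element_order_dvd_maximal_order[OF assms(2) y(1)] .
      have "ord x dvd ord z"
        using d z(3) assms(4) unfolding gcd_maximal_orders_def by (meson Gcd_dvd dvd_trans)
      then have "ord (z [^]\<^bsub>G\<^esub> (ord z div ord x)) = ord x" (is "ord ?a = _")
        using ord_eq_div_pow assms(2) z(1) by blast
      moreover have "ord (z [^]\<^bsub>G\<^esub> (ord z div ord y)) = ord y" (is "ord ?b = _")
        using ord_eq_div_pow assms(2) z by blast
      \<comment> \<open>Adjacency requires distinct commuting representatives; two powers of
        \<open>z\<close> might coincide if their orders agreed, which is why that case was split
        off.\<close>
      moreover have "?a \<noteq> ?b"
        using calculation False by metis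
      moreover have "?a \<otimes>\<^bsub>G\<^esub> ?b = ?b \<otimes>\<^bsub>G\<^esub> ?a"
        using nat_pow_commute[of z z] z(1) by simp
      moreover have "?a \<in> carrier G" "?b \<in> carrier G"
        using z(1) by simp_all
      ultimately show ?thesis
        using assms(3) y unfolding order_super_commuting_graph_def by auto
    qed
    then show "dominant_vertex (order_super_commuting_graph G) x"
      using assms(3) unfolding dominant_vertex_def
      by (simp add: order_super_commuting_graph_def)
  qed
qed

end
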